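(* Let $n\ge 2$ and let $(b,c,d)$ be a triad in the Cayley-Dickson algebra $\mathbb A_n$, and put $a=(bc)d$. Reversing an associator of three distinct elements of $\{a,b,c,d\}$ only changes its sign, $[x,y,z]=-[z,y,x]$, so that the $24$ associators $[x,y,z]$ with $x,y,z$ distinct elements of the list $a,b,c,d$ reduce to $12$. These $12$ fall into the following three classes, and within each class either all four associators are zero or all four are non-zero: Type 1: $[b,a,c],\ [b,d,c],\ [a,b,d],\ [a,c,d]$; Type 2: $[a,b,c],\ [b,c,d],\ [b,a,d],\ [a,d,c]$; Type 3: $[a,c,b],\ [c,b,d],\ [a,d,b],\ [c,a,d]$.
   Context: The real algebras $\mathbb A_n$ are defined recursively: $\mathbb A_0=\mathbb R$ with trivial conjugation, and $\mathbb A_n=\mathbb A_{n-1}\oplus\mathbb A_{n-1}$ with $(x,y)(z,w)=(xz-w^*y,\; wx+yz^* )$ and $(x,y)^*=(x^*,-y)$. The graded basis of $\mathbb A_n$ is $\{\mathrm o_\alpha:\alpha\subseteq\{1,\dots,n\}\}$, with $\mathrm o_\emptyset=1$ and, for $\alpha\subseteq\{1,\dots,n-1\}$, $\mathrm o_\alpha=(\mathrm o_\alpha,0)$ and $\mathrm o_{\alpha\cup\{n\}}=(0,\mathrm o_\alpha)$. Pure basis elements are those with $\alpha\neq\emptyset$. The natural order on basis elements is: $\mathrm o_\alpha<\mathrm o_\beta$ iff $\alpha\ne\beta$ and the largest element of the symmetric difference of $\alpha$ and $\beta$ lies in $\beta$. A triad is a triple $(b,c,d)$ of pure basis elements with $b<c<d$.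 The associator is $[x,y,z]=(xy)z-x(yz)$. *)

theory Defs
  imports Complex_Main
begin

text \<open>
  One datatype carries all the algebras \<open>A\<^sub>n\<close>: the elements of \<open>A\<^sub>n\<close> are the complete binary
  trees of depth \<open>n\<close> with real leaves, \<open>Dbl x y\<close> being the pair \<open>(x, y)\<close> of the doubling
  \<open>A\<^sub>n = A\<^sub>n\<^sub>-\<^sub>1 \<oplus> A\<^sub>n\<^sub>-\<^sub>1\<close>.  The binary operations are left undefined on trees of
  different shape; by the closure lemmas below this never happens inside a fixed \<open>A\<^sub>n\<close>.
\<close>

datatype cd = Scal real | Dbl cd cd

fun cd_alg :: "nat \<Rightarrow> cd set" where
  "cd_alg 0 = range Scal"
| "cd_alg (Suc n) = {Dbl x y | x y. x \<in> cd_alg n \<and> y \<in> cd_alg n}"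

instantiation cd :: "{plus, minus, uminus}"
begin

fun plus_cd :: "cd \<Rightarrow> cd \<Rightarrow> cd" where
  "Scal r + Scal s = Scal (r + s)"
| "Dbl x y + Dbl z w = Dbl (x + z) (y + w)"
| "(_ :: cd) + _ = undefined"

fun minus_cd :: "cd \<Rightarrow> cd \<Rightarrow> cd" where
  "Scal r - Scal s = Scal (r - s)"
| "Dbl x y - Dbl z w = Dbl (x - z) (y - w)"
| "(_ :: cd) - _ = undefined"

primrec uminus_cd :: "cd \<Rightarrow> cd" where
  "- Scal r = Scal (- r)"
| "- Dbl x y = Dbl (- x) (- y)"

instance ..

end

primrec cd_cnj :: "cd \<Rightarrow> cd" where
  "cd_cnj (Scal r) = Scal r"
| "cd_cnj (Dbl x y) = Dbl (cd_cnj x) (- y)"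

lemma size_uminus_cd [simp]: "size (- x) = size (x :: cd)"
  by (induction x) simp_all

lemma size_cd_cnj [simp]: "size (cd_cnj x) = size x"
  by (induction x) simp_all

instantiation cd :: times
begin

function (sequential) times_cd :: "cd \<Rightarrow> cd \<Rightarrow> cd" where
  "Scal r * Scal s = Scal (r * s)"
| "Dbl x y * Dbl z w = Dbl (x * z - cd_cnj w * y) (w * x + y * cd_cnj z)"
| "(_ :: cd) * _ = undefined"
  by pat_completeness auto
termination
  by (relation "measure (\<lambda>(x, y). size x + size y)") auto

instance ..

end

lemma cd_alg_closed:
  shows cd_alg_plus: "x \<in> cd_alg n \<Longrightarrow> y \<in> cd_alg n \<Longrightarrow> x + y \<in> cd_alg n"
    and cd_alg_minus: "x \<in> cd_alg n \<Longrightarrow> y \<in> cd_alg n \<Longrightarrow> x - y \<in> cd_alg n"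
    and cd_alg_uminus: "x \<in> cd_alg n \<Longrightarrow> - x \<in> cd_alg n"
  by (induction n arbitrary: x y) auto

lemma cd_alg_cnj: "x \<in> cd_alg n \<Longrightarrow> cd_cnj x \<in> cd_alg n"
  by (induction n arbitrary: x) (auto simp: cd_alg_uminus)

lemma cd_alg_times: "x \<in> cd_alg n \<Longrightarrow> y \<in> cd_alg n \<Longrightarrow> x * y \<in> cd_alg n"
proof (induction n arbitrary: x y)
  case 0
  then show ?case by auto
next
  case (Suc n)
  then show ?case by (auto intro!: Suc.IH cd_alg_plus cd_alg_minus cd_alg_cnj)
qed

text \<open>The zero element of \<open>A\<^sub>n\<close> depends on \<open>n\<close>, hence is not an instance of the class \<open>zero\<close>.\<close>

primrec cd_zero :: "nat \<Rightarrow> cd" where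
  "cd_zero 0 = Scal 0"
| "cd_zero (Suc n) = Dbl (cd_zero n) (cd_zero n)"

text \<open>\<open>cd_basis n \<alpha>\<close> is the basis element \<open>o\<^sub>\<alpha>\<close> of \<open>A\<^sub>n\<close>; it is meant for \<open>\<alpha> \<subseteq> {1..n}\<close> only.\<close>

primrec cd_basis :: "nat \<Rightarrow> nat set \<Rightarrow> cd" where
  "cd_basis 0 \<alpha> = Scal 1"
| "cd_basis (Suc n) \<alpha> =
     (if Suc n \<in> \<alpha> then Dbl (cd_zero n) (cd_basis n (\<alpha> - {Suc n}))
      else Dbl (cd_basis n \<alpha>) (cd_zero n))"

lemma cd_zero_in_alg: "cd_zero n \<in> cd_alg n"
  by (induction n) auto

lemma cd_basis_in_alg: "cd_basis n \<alpha> \<in> cd_alg n"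
  by (induction n arbitrary: \<alpha>) (auto simp: cd_zero_in_alg)

definition pure_basis :: "nat \<Rightarrow> cd set" where
  "pure_basis n = {cd_basis n \<alpha> | \<alpha>. \<alpha> \<subseteq> {1..n} \<and> \<alpha> \<noteq> {}}"

definition basis_less :: "nat \<Rightarrow> cd \<Rightarrow> cd \<Rightarrow> bool" where
  "basis_less n x y \<longleftrightarrow>
     (\<exists>\<alpha> \<beta>. \<alpha> \<subseteq> {1..n} \<and> \<beta> \<subseteq> {1..n} \<and> x = cd_basis n \<alpha> \<and> y = cd_basis n \<beta> \<and>
            \<alpha> \<noteq> \<beta> \<and> Max (sym_diff \<alpha> \<beta>) \<in> \<beta>)"

definition triad :: "nat \<Rightarrow> cd \<Rightarrow> cd \<Rightarrow> cd \<Rightarrow> bool" where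
  "triad n b c d \<longleftrightarrow>
     b \<in> pure_basis n \<and> c \<in> pure_basis n \<and> d \<in> pure_basis n \<and>
     basis_less n b c \<and> basis_less n c d"

definition associator :: "cd \<Rightarrow> cd \<Rightarrow> cd \<Rightarrow> cd" where
  "associator x y z = (x * y) * z - x * (y * z)"

definition distinct_triples :: "'a set \<Rightarrow> ('a \<times> 'a \<times> 'a) set" where
  "distinct_triples S = {(x, y, z). x \<in> S \<and> y \<in> S \<and> z \<in> S \<and> distinct [x, y, z]}"

definition reverse_triple :: "'a \<times> 'a \<times> 'a \<Rightarrow> 'a \<times> 'a \<times> 'a" where
  "reverse_triple = (\<lambda>(x, y, z). (z, y, x))"

definition type1 :: "'a \<Rightarrow> 'a \<Rightarrow> 'a \<Rightarrow> 'a \<Rightarrow> ('a \<times> 'a \<times> 'a) set" where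
  "type1 a b c d = {(b, a, c), (b, d, c), (a, b, d), (a, c, d)}"

definition type2 :: "'a \<Rightarrow> 'a \<Rightarrow> 'a \<Rightarrow> 'a \<Rightarrow> ('a \<times> 'a \<times> 'a) set" where
  "type2 a b c d = {(a, b, c), (b, c, d), (b, a, d), (a, d, c)}"

definition type3 :: "'a \<Rightarrow> 'a \<Rightarrow> 'a \<Rightarrow> 'a \<Rightarrow> ('a \<times> 'a \<times> 'a) set" where
  "type3 a b c d = {(a, c, b), (c, b, d), (a, d, b), (c, a, d)}"

end

theory Submission
  imports Defs
begin

text \<open>
  Products of basis elements are \<open>o\<^sub>\<alpha> o\<^sub>\<beta> = s(\<alpha>, \<beta>) o\<^sub>\<gamma>\<close> with \<open>\<gamma>\<close> the symmetric difference
  and \<open>s(\<alpha>, \<beta>) = \<plusminus>1\<close>.  Two distinct pure basis elements generate a quaternion algebra, so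
  \<open>s\<close> is cyclically invariant on triples \<open>\<alpha>, \<beta>, \<gamma>\<close>.  For four distinct nonempty sets
  \<open>p, q, r, t\<close> with empty total symmetric difference, this gives the coefficient of
  \<open>[o\<^sub>p, o\<^sub>q, o\<^sub>r]\<close> as \<open>s(p, q) s(r, t) - s(q, r) s(t, p)\<close>, which only changes sign under the
  rotation \<open>p, q, r, t \<mapsto> q, r, t, p\<close> and under reversal of \<open>p, q, r\<close>.  If one of the four is
  empty, every coefficient vanishes.  Up to reversal, the three types are the three orbits of
  this rotation on the cyclic arrangements of \<open>a, b, c, d\<close>.
\<close>

section \<open>Symmetric difference of index sets\<close>

definition sdiff :: "'a set \<Rightarrow> 'a set \<Rightarrow> 'a set" (infixl "\<triangle>" 65) where
  "A \<triangle> B = sym_diff A B"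

lemma sdiff_comm: "A \<triangle> B = B \<triangle> A"
  by (auto simp: sdiff_def)

lemma sdiff_assoc: "(A \<triangle> B) \<triangle> C = A \<triangle> (B \<triangle> C)"
  by (auto simp: sdiff_def)

lemma sdiff_left_comm: "A \<triangle> (B \<triangle> C) = B \<triangle> (A \<triangle> C)"
  by (auto simp: sdiff_def)

lemmas sdiff_ac = sdiff_assoc sdiff_comm sdiff_left_comm

lemma sdiff_simps [simp]:
  "A \<triangle> A = {}" "{} \<triangle> A = A" "A \<triangle> {} = A" "A \<triangle> (A \<triangle> B) = B"
  "A \<triangle> B = {} \<longleftrightarrow> A = B" "A \<triangle> B = A \<longleftrightarrow> B = {}" "A = A \<triangle> B \<longleftrightarrow> B = {}"
  by (auto simp: sdiff_def)

lemma sdiff_subset: "A \<subseteq> C \<Longrightarrow> B \<subseteq> C \<Longrightarrow> A \<triangle> B \<subseteq> C"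
  by (auto simp: sdiff_def)

section \<open>Real scalars and zero in the algebras\<close>

text \<open>A plain function instead of the vector space class: trees of all depths share the type
  \<open>cd\<close>, and sums across different shapes are undefined. For the same reason later laws
  tie their operands to one \<open>cd_alg n\<close>.\<close>

primrec cd_scale :: "real \<Rightarrow> cd \<Rightarrow> cd" where
  "cd_scale r (Scal s) = Scal (r * s)"
| "cd_scale r (Dbl x y) = Dbl (cd_scale r x) (cd_scale r y)"

lemma cd_scale_simps [simp]:
  "cd_scale 1 x = x"
  "cd_scale r (cd_scale s x) = cd_scale (r * s) x"
  "- cd_scale r x = cd_scale (- r) x"
  "cd_cnj (cd_scale r x) = cd_scale r (cd_cnj x)"
  "cd_scale r (- x) = cd_scale (- r) x"
  by (induction x) simp_all

lemma uminus_eq_cd_scale: "- x = cd_scale (- 1) x" for x :: cd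
  by (induction x) simp_all

lemma cd_scale_diff: "cd_scale r x - cd_scale s x = cd_scale (r - s) x"
  by (induction x) (simp_all add: algebra_simps)

lemma cd_zero_simps [simp]:
  "cd_scale r (cd_zero n) = cd_zero n"
  "- cd_zero n = cd_zero n"
  "cd_cnj (cd_zero n) = cd_zero n"
  by (induction n) simp_all

lemma cd_scale_0: "x \<in> cd_alg n \<Longrightarrow> cd_scale 0 x = cd_zero n"
  by (induction n arbitrary: x) auto

lemma cd_scale_in_alg: "x \<in> cd_alg n \<Longrightarrow> cd_scale r x \<in> cd_alg n"
  by (induction n arbitrary: x) auto

lemma cd_zero_add [simp]:
  assumes "x \<in> cd_alg n"
  shows "cd_zero n + x = x" "x + cd_zero n = x" "x - cd_zero n = x" "cd_zero n - x = - x"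
  using assms by (induction n arbitrary: x) auto

lemma cd_zero_mult [simp]:
  assumes "x \<in> cd_alg n"
  shows "cd_zero n * x = cd_zero n" "x * cd_zero n = cd_zero n"
  using assms by (induction n arbitrary: x) (auto simp: cd_zero_in_alg cd_alg_cnj)

lemma cd_scale_add:
  assumes "x \<in> cd_alg n" "y \<in> cd_alg n"
  shows "cd_scale r (x + y) = cd_scale r x + cd_scale r y"
    "cd_scale r (x - y) = cd_scale r x - cd_scale r y"
  using assms by (induction n arbitrary: x y) (auto simp: algebra_simps)

lemma cd_scale_mult:
  assumes "x \<in> cd_alg n" "y \<in> cd_alg n"
  shows "cd_scale r x * y = cd_scale r (x * y)" "x * cd_scale r y = cd_scale r (x * y)"
proof -
  have "cd_scale r x * y = cd_scale r (x * y) \<and> x * cd_scale r y = cd_scale r (x * y)"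
    using assms
  proof (induction n arbitrary: x y)
    case 0
    then show ?case by auto
  next
    case (Suc n)
    then obtain p q u v where "x = Dbl p q" "y = Dbl u v"
      and "p \<in> cd_alg n" "q \<in> cd_alg n" "u \<in> cd_alg n" "v \<in> cd_alg n" by auto
    then show ?case
      by (simp add: Suc.IH cd_scale_add[of _ n] cd_alg_times cd_alg_cnj)
  qed
  then show "cd_scale r x * y = cd_scale r (x * y)" "x * cd_scale r y = cd_scale r (x * y)"
    by auto
qed

lemma cd_scale_basis_eq_zero_iff: "cd_scale r (cd_basis n A) = cd_zero n \<longleftrightarrow> r = 0"
  by (induction n arbitrary: A) (auto simp: cd_scale_0 cd_basis_in_alg)

text \<open>Both scalars are non-zero, because the common value is not zero. Which half of that pair
  vanishes then decides whether \<open>Suc n\<close> belongs to the index set, and the other half is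
  handled by induction.\<close>

lemma cd_scale_basis_inject:
  assumes "A \<subseteq> {1..n}" "B \<subseteq> {1..n}" "r \<noteq> 0" "cd_scale r (cd_basis n A) = cd_scale s (cd_basis n B)"
  shows "A = B"
  using assms
proof (induction n arbitrary: A B)
  case 0
  then show ?case by simp
next
  case (Suc n)
  have sub: "A - {Suc n} \<subseteq> {1..n}" "B - {Suc n} \<subseteq> {1..n}"
    using Suc.prems(1,2) by (fastforce simp: le_Suc_eq)+
  have "s \<noteq> 0"
    using Suc.prems(3,4) cd_scale_basis_eq_zero_iff by metis
  then have "Suc n \<in> A \<longleftrightarrow> Suc n \<in> B"
    using Suc.prems(3,4) cd_scale_basis_eq_zero_iff
    by (auto split: if_splits)
  moreover have "A - {Suc n} = B - {Suc n}"
    using Suc.prems(3,4) calculation by (intro Suc.IH[OF sub]) (auto split: if_splits)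
  ultimately show ?case by auto
qed

section \<open>Signs in the multiplication table of the basis\<close>

definition cnj_sign :: "'a set \<Rightarrow> real" where
  "cnj_sign A = (if A = {} then 1 else - 1)"

definition comm_sign :: "'a set \<Rightarrow> 'a set \<Rightarrow> real" where
  "comm_sign A B = (if A = {} \<or> B = {} \<or> A = B then 1 else - 1)"

fun mult_sign :: "nat \<Rightarrow> nat set \<Rightarrow> nat set \<Rightarrow> real" where
  "mult_sign 0 A B = 1"
| "mult_sign (Suc n) A B =
    (let A' = A - {Suc n}; B' = B - {Suc n} in
     if Suc n \<in> A then
       if Suc n \<in> B then - cnj_sign B' * mult_sign n B' A' else cnj_sign B * mult_sign n A' B
     else
       if Suc n \<in> B then mult_sign n B' A else mult_sign n A B)"

lemma cd_basis_cnj: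
  "A \<subseteq> {1..n} \<Longrightarrow> cd_cnj (cd_basis n A) = cd_scale (cnj_sign A) (cd_basis n A)"
proof (induction n arbitrary: A)
  case 0
  then show ?case by (simp add: cnj_sign_def)
next
  case (Suc n)
  show ?case
  proof (cases "Suc n \<in> A")
    case True
    then show ?thesis by (auto simp: cnj_sign_def uminus_eq_cd_scale)
  next
    case False
    then have "A \<subseteq> {1..n}"
      using Suc.prems by (fastforce simp: le_Suc_eq)
    then show ?thesis
      using False by (simp add: Suc.IH)
  qed
qed

text \<open>The case split behind the sign inductions: the basis element lies in the left or in the
  right summand of the doubling.\<close>

lemma insert_Suc_cases:
  assumes "A \<subseteq> {1..Suc n}"
  obtains "A \<subseteq> {1..n}" "Suc n \<notin> A" "A - {Suc n} = A"
  | A' where "A' \<subseteq> {1..n}" "Suc n \<notin> A'" "A = insert (Suc n) A'" "A - {Suc n} = A'"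
proof (cases "Suc n \<in> A")
  case True
  then show thesis
    using assms by (intro that(2)[of "A - {Suc n}"]) (fastforce simp: le_Suc_eq)+
next
  case False
  then show thesis
    using assms by (intro that(1)) (fastforce simp: le_Suc_eq)+
qed

lemma sdiff_insert:
  assumes "x \<notin> A" "x \<notin> B"
  shows "insert x A \<triangle> B = insert x (A \<triangle> B)" "A \<triangle> insert x B = insert x (A \<triangle> B)"
    "insert x A \<triangle> insert x B = A \<triangle> B" "x \<notin> A \<triangle> B" "A \<triangle> B - {x} = A \<triangle> B"
  using assms by (auto simp: sdiff_def)

lemma cd_basis_mult:
  "A \<subseteq> {1..n} \<Longrightarrow> B \<subseteq> {1..n} \<Longrightarrow>
    cd_basis n A * cd_basis n B = cd_scale (mult_sign n A B) (cd_basis n (A \<triangle> B))"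
proof (induction n arbitrary: A B)
  case 0
  then show ?case by simp
next
  case (Suc n)
  note simps = Suc.IH sdiff_insert Let_def cd_zero_in_alg cd_basis_in_alg cd_basis_cnj
    cd_alg_times cd_scale_in_alg cd_scale_mult[of _ n] sdiff_comm
  show ?case
    using Suc.prems(1)
  proof (cases rule: insert_Suc_cases)
    case 1
    note A = 1
    from Suc.prems(2) show ?thesis
    proof (cases rule: insert_Suc_cases)
      case 1
      with A show ?thesis by (simp add: simps)
    next
      case (2 B')
      with A show ?thesis by (simp add: simps)
    qed
  next
    case (2 A')
    note A = 2
    from Suc.prems(2) show ?thesis
    proof (cases rule: insert_Suc_cases)
      case 1
      with A show ?thesis by (simp add: simps)
    next
      case (2 B')
      with A show ?thesis by (simp add: simps)
    qed
  qed
qed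

lemma mult_sign_cases: "mult_sign n A B = 1 \<or> mult_sign n A B = - 1"
proof (induction n arbitrary: A B)
  case 0
  then show ?case by simp
next
  case (Suc n)
  then show ?case
    by (simp add: Let_def cnj_sign_def) (metis minus_minus)
qed

lemma mult_sign_empty [simp]:
  "mult_sign n {} A = 1" "mult_sign n A {} = 1"
proof -
  have "mult_sign n {} A = 1 \<and> mult_sign n A {} = 1"
    by (induction n arbitrary: A) (auto simp: Let_def cnj_sign_def)
  then show "mult_sign n {} A = 1" "mult_sign n A {} = 1" by auto
qed

lemma mult_sign_self:
  "A \<subseteq> {1..n} \<Longrightarrow> mult_sign n A A = cnj_sign A"
proof (induction n arbitrary: A)
  case 0
  then show ?case by (simp add: cnj_sign_def)
next
  case (Suc n)
  from Suc.prems show ?case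
    by (cases rule: insert_Suc_cases) (auto simp: Suc.IH cnj_sign_def Let_def)
qed

text \<open>If exactly one set contains \<open>Suc n\<close>, the terms wx and yz^* multiply the
  halves in the same order, so the two signs differ only by a conjugation sign. If both contain it,
  the induction hypothesis combines with the two conjugation signs.\<close>

lemma mult_sign_commute:
  "A \<subseteq> {1..n} \<Longrightarrow> B \<subseteq> {1..n} \<Longrightarrow> mult_sign n B A = comm_sign A B * mult_sign n A B"
proof (induction n arbitrary: A B)
  case 0
  then show ?case by (simp add: comm_sign_def)
next
  case (Suc n)
  from Suc.prems(1) show ?case
  proof (cases rule: insert_Suc_cases)
    case 1
    note A = 1
    from Suc.prems(2) show ?thesis
    proof (cases rule: insert_Suc_cases)
      case 1
      with A Suc.IH[of A B] show ?thesis by simp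
    next
      case (2 B')
      with A show ?thesis by (auto simp: Let_def comm_sign_def cnj_sign_def)
    qed
  next
    case (2 A')
    note A = 2
    from Suc.prems(2) show ?thesis
    proof (cases rule: insert_Suc_cases)
      case 1
      with A show ?thesis by (auto simp: Let_def comm_sign_def cnj_sign_def)
    next
      case (2 B')
      have "mult_sign n B' A' = comm_sign A' B' * mult_sign n A' B'"
        using A(1) 2(1) by (rule Suc.IH)
      moreover have "A \<noteq> {}" "B \<noteq> {}" "Suc n \<in> A" "Suc n \<in> B"
        using A(3) 2(3) by auto
      moreover have "A = B \<longleftrightarrow> A' = B'"
        unfolding A(3) 2(3) using A(2) 2(2) by (rule insert_ident)
      ultimately show ?thesis
        using A(4) 2(4) by (simp add: Let_def comm_sign_def cnj_sign_def)
    qed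
  qed
qed

text \<open>This is left alternativity on basis elements, o_A (o_A o_B) = (o_A o_A) o_B, where the
  square of o_A is \<open>cnj_sign A\<close>. It holds at every level, although the algebras
  themselves stop being alternative. Doubling exchanges factors, so the induction also relies on
  \<open>mult_sign_commute\<close>.\<close>

lemma mult_sign_sdiff:
  "A \<subseteq> {1..n} \<Longrightarrow> B \<subseteq> {1..n} \<Longrightarrow>
    mult_sign n A (A \<triangle> B) = cnj_sign A * mult_sign n A B"
proof (induction n arbitrary: A B)
  case 0
  then show ?case by (simp add: cnj_sign_def)
next
  case (Suc n)
  from Suc.prems(1) show ?case
  proof (cases rule: insert_Suc_cases)
    case 1
    note A = 1
    from Suc.prems(2) show ?thesis
    proof (cases rule: insert_Suc_cases)
      case 1
      with A Suc.IH[of A B] show ?thesis by (simp add: sdiff_insert Let_def)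
    next
      case (2 B')
      with A Suc.IH[of A B'] mult_sign_commute[of A n B'] mult_sign_commute[of A n "A \<triangle> B'"]
      show ?thesis
        by (auto simp: sdiff_subset sdiff_insert Let_def comm_sign_def cnj_sign_def split: if_splits)
    qed
  next
    case (2 A')
    note A = 2
    from Suc.prems(2) show ?thesis
    proof (cases rule: insert_Suc_cases)
      case 1
      with A Suc.IH[of A' B] mult_sign_commute[of A' n "A' \<triangle> B"] show ?thesis
        by (auto simp: sdiff_subset sdiff_insert Let_def comm_sign_def cnj_sign_def split: if_splits)
    next
      case (2 B')
      with A Suc.IH[of A' B'] mult_sign_commute[of A' n B'] show ?thesis
        by (auto simp: sdiff_subset sdiff_insert Let_def comm_sign_def cnj_sign_def split: if_splits)
    qed
  qed
qed

section \<open>Coefficients of associators of basis elements\<close>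

definition assoc_coeff :: "nat \<Rightarrow> nat set \<Rightarrow> nat set \<Rightarrow> nat set \<Rightarrow> real" where
  "assoc_coeff n A B C =
    mult_sign n A B * mult_sign n (A \<triangle> B) C - mult_sign n B C * mult_sign n A (B \<triangle> C)"

lemma associator_scale_basis:
  assumes "A \<subseteq> {1..n}" "B \<subseteq> {1..n}" "C \<subseteq> {1..n}"
  shows "associator (cd_scale p (cd_basis n A)) (cd_scale q (cd_basis n B)) (cd_scale r (cd_basis n C))
    = cd_scale (p * q * r * assoc_coeff n A B C) (cd_basis n (A \<triangle> B \<triangle> C))"
  using assms
  by (simp add: associator_def cd_scale_mult[of _ n] cd_basis_in_alg cd_basis_mult cd_scale_in_alg
      sdiff_subset cd_scale_diff sdiff_assoc assoc_coeff_def algebra_simps)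

lemma mult_sign_anticommute:
  assumes "A \<subseteq> {1..n}" "B \<subseteq> {1..n}" "A \<noteq> {}" "B \<noteq> {}" "A \<noteq> B"
  shows "mult_sign n B A = - mult_sign n A B"
  using mult_sign_commute[OF assms(1,2)] assms(3-5) by (simp add: comm_sign_def)

text \<open>Alternativity contributes the factor -1, the square of a pure basis element, and
  anticommuting one pair cancels it.\<close>

lemma mult_sign_cyclic:
  assumes "A \<subseteq> {1..n}" "B \<subseteq> {1..n}" "A \<noteq> {}" "B \<noteq> {}" "A \<noteq> B"
  shows "mult_sign n (A \<triangle> B) A = mult_sign n A B" "mult_sign n B (A \<triangle> B) = mult_sign n A B"
proof -
  show "mult_sign n (A \<triangle> B) A = mult_sign n A B"
    using mult_sign_anticommute[of A n "A \<triangle> B"] mult_sign_sdiff[of A n B] assms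
    by (simp add: cnj_sign_def sdiff_subset)
  show "mult_sign n B (A \<triangle> B) = mult_sign n A B"
    using mult_sign_anticommute[of A n B] mult_sign_sdiff[of B n A] assms
    by (simp add: cnj_sign_def sdiff_comm)
qed

text \<open>A factor o_\<emptyset> = 1 associates with everything. Otherwise \<open>C\<close> is
  \<open>A \<triangle> B\<close>, and by cyclicity both bracketings equal
  \<open>mult_sign n A B\<close> times the square -1 of a pure element.\<close>

lemma assoc_coeff_eq_0:
  assumes "A \<subseteq> {1..n}" "B \<subseteq> {1..n}" "C \<subseteq> {1..n}" "A \<noteq> B"
    and "A = {} \<or> B = {} \<or> C = {} \<or> A \<triangle> B \<triangle> C = {}"
  shows "assoc_coeff n A B C = 0"
proof (cases "A = {} \<or> B = {} \<or> C = {}")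
  case True
  then show ?thesis by (auto simp: assoc_coeff_def)
next
  case False
  with assms(5) have "C = A \<triangle> B" by simp
  then show ?thesis
    using assms False mult_sign_cyclic[of A n B]
    by (simp add: assoc_coeff_def mult_sign_self sdiff_subset cnj_sign_def sdiff_left_comm)
qed

text \<open>Expressed by the fourth factor, the coefficient compares the two ways of pairing
  neighbours on the cycle \<open>A, B, C, D\<close>.\<close>

lemma assoc_coeff_cycle:
  assumes "A \<subseteq> {1..n}" "B \<subseteq> {1..n}" "C \<subseteq> {1..n}"
    and "A \<noteq> {}" "C \<noteq> {}" "D \<noteq> {}" "C \<noteq> D" "A \<noteq> D" "D = A \<triangle> B \<triangle> C"
  shows "assoc_coeff n A B C =
    mult_sign n A B * mult_sign n C D - mult_sign n B C * mult_sign n D A"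
proof -
  have D: "D \<subseteq> {1..n}" using assms by (simp add: sdiff_subset)
  \<comment> \<open>Each inner product has the index set of a product of two cyclic neighbours, so
    cyclicity turns the outer signs into \<open>mult_sign n C D\<close> and
    \<open>mult_sign n D A\<close>.\<close>
  have eq: "A \<triangle> B = C \<triangle> D" "B \<triangle> C = D \<triangle> A"
    unfolding assms(9) by (auto simp: sdiff_def)
  show ?thesis
    using mult_sign_cyclic(1)[of C n D] mult_sign_cyclic(2)[of D n A] assms D
    unfolding assoc_coeff_def eq by simp
qed

text \<open>In \<open>assoc_coeff_cycle\<close> the rotation exchanges the two terms of the
  difference. Reversal exchanges them as well, after anticommuting both pairs in each term, where
  the signs cancel.\<close>

lemma assoc_coeff_symmetries:
  assumes "A \<subseteq> {1..n}" "B \<subseteq> {1..n}" "C \<subseteq> {1..n}" "distinct [A, B, C, D]" "D = A \<triangle> B \<triangle> C"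
  shows "assoc_coeff n C B A = - assoc_coeff n A B C"
    and "assoc_coeff n B C D = - assoc_coeff n A B C"
proof -
  have D: "D \<subseteq> {1..n}" using assms by (simp add: sdiff_subset)
  have eq: "D = C \<triangle> B \<triangle> A" "A = B \<triangle> C \<triangle> D"
    unfolding assms(5) by (auto simp: sdiff_def)
  have ne: "A \<noteq> B" "A \<noteq> C" "A \<noteq> D" "B \<noteq> C" "B \<noteq> D" "C \<noteq> D"
    using assms(4) by auto
  have "assoc_coeff n C B A = - assoc_coeff n A B C \<and>
    assoc_coeff n B C D = - assoc_coeff n A B C"
  proof (cases "A = {} \<or> B = {} \<or> C = {} \<or> D = {}")
    \<comment> \<open>The cycle formula is restricted to pure factors. With an empty set among the
      four, all three coefficients are zero and both equations are trivial.\<close>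
    case True
    have "assoc_coeff n A B C = 0"
      using True assms(5) by (intro assoc_coeff_eq_0 assms(1-3) ne) metis
    moreover have "assoc_coeff n C B A = 0"
      using True eq(1) by (intro assoc_coeff_eq_0 assms(1-3) ne(4)[symmetric]) metis
    moreover have "assoc_coeff n B C D = 0"
      using True eq(2) by (intro assoc_coeff_eq_0 assms(2,3) D ne) metis
    ultimately show ?thesis by simp
  next
    case False
    then have nonempty: "A \<noteq> {}" "B \<noteq> {}" "C \<noteq> {}" "D \<noteq> {}" by auto
    note coeff =
      assoc_coeff_cycle[OF assms(1-3) nonempty(1,3,4) ne(6,3) assms(5)]
      assoc_coeff_cycle[OF assms(3,2,1) nonempty(3,1,4) ne(3,6) eq(1)]
      assoc_coeff_cycle[OF assms(2,3) D nonempty(2,4,1) ne(3)[symmetric] ne(1)[symmetric] eq(2)]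
    note anticomm = mult_sign_anticommute[OF assms(1,2) nonempty(1,2) ne(1)]
      mult_sign_anticommute[OF assms(2,3) nonempty(2,3) ne(4)]
      mult_sign_anticommute[OF assms(3) D nonempty(3,4) ne(6)]
      mult_sign_anticommute[OF D assms(1) nonempty(4,1) ne(3)[symmetric]]
    show ?thesis
      unfolding coeff anticomm by simp
  qed
  then show "assoc_coeff n C B A = - assoc_coeff n A B C"
    "assoc_coeff n B C D = - assoc_coeff n A B C" by auto
qed

section \<open>Non-zero multiples of basis elements\<close>

text \<open>The product \<open>a\<close> is a basis element only up to sign. Arbitrary non-zero
  scalars give a notion closed under products, and they do not affect whether an associator
  vanishes.\<close>

definition signed_basis :: "nat \<Rightarrow> nat set \<Rightarrow> cd \<Rightarrow> bool" where
  "signed_basis n A x \<longleftrightarrow> A \<subseteq> {1..n} \<and> (\<exists>r. r \<noteq> 0 \<and> x = cd_scale r (cd_basis n A))"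

lemma signed_basis_inject: "signed_basis n A x \<Longrightarrow> signed_basis n B x \<Longrightarrow> A = B"
  unfolding signed_basis_def using cd_scale_basis_inject by metis

lemma signed_basis_basis: "A \<subseteq> {1..n} \<Longrightarrow> signed_basis n A (cd_basis n A)"
  unfolding signed_basis_def by (metis cd_scale_simps(1) zero_neq_one)

lemma signed_basis_mult:
  assumes "signed_basis n A x" "signed_basis n B y"
  shows "signed_basis n (A \<triangle> B) (x * y)"
proof -
  from assms obtain r s where "A \<subseteq> {1..n}" "B \<subseteq> {1..n}" "r \<noteq> 0" "s \<noteq> 0"
    and "x = cd_scale r (cd_basis n A)" "y = cd_scale s (cd_basis n B)"
    unfolding signed_basis_def by blast
  moreover from this have "x * y = cd_scale (r * s * mult_sign n A B) (cd_basis n (A \<triangle> B))"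
    by (simp add: cd_scale_mult[of _ n] cd_scale_in_alg cd_basis_in_alg cd_basis_mult mult_ac)
  moreover have "mult_sign n A B \<noteq> 0" using mult_sign_cases[of n A B] by auto
  ultimately show ?thesis
    unfolding signed_basis_def by (metis sdiff_subset mult_eq_0_iff)
qed

text \<open>Reversal keeps the basis element o_D, so it yields an equation. Rotation replaces o_D by
  o_A, so only vanishing can be compared.\<close>

lemma associator_symmetries:
  assumes "signed_basis n A a" "signed_basis n B b" "signed_basis n C c" "signed_basis n D d"
    and "distinct [A, B, C, D]" "D = A \<triangle> B \<triangle> C"
  shows "associator a b c = - associator c b a"
    and "associator b c d = cd_zero n \<longleftrightarrow> associator a b c = cd_zero n"
proof -
  from assms obtain p q r s where sub: "A \<subseteq> {1..n}" "B \<subseteq> {1..n}" "C \<subseteq> {1..n}" "D \<subseteq> {1..n}"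
    and nz: "p \<noteq> 0" "q \<noteq> 0" "r \<noteq> 0" "s \<noteq> 0"
    and eq: "a = cd_scale p (cd_basis n A)" "b = cd_scale q (cd_basis n B)"
      "c = cd_scale r (cd_basis n C)" "d = cd_scale s (cd_basis n D)"
    unfolding signed_basis_def by blast
  note sym = assoc_coeff_symmetries[OF sub(1-3) assms(5,6)]
  have "C \<triangle> B \<triangle> A = A \<triangle> B \<triangle> C" by (auto simp: sdiff_def)
  then show "associator a b c = - associator c b a"
    unfolding eq using sub sym(1) by (simp add: associator_scale_basis mult_ac)
  show "associator b c d = cd_zero n \<longleftrightarrow> associator a b c = cd_zero n"
    unfolding eq using sub nz sym(2)
    by (simp add: associator_scale_basis cd_scale_basis_eq_zero_iff)
qed

lemma triad_index_sets:
  assumes "triad n b c d"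
  obtains B C D where "signed_basis n B b" "signed_basis n C c" "signed_basis n D d"
    "distinct [B, C, D]"
proof -
  from assms obtain B C D
    where sub: "B \<subseteq> {1..n}" "C \<subseteq> {1..n}" "D \<subseteq> {1..n}"
      and eq: "b = cd_basis n B" "c = cd_basis n C" "d = cd_basis n D"
    unfolding triad_def pure_basis_def by blast
  have inj: "X = Y" if "cd_basis n X = cd_basis n Y" "X \<subseteq> {1..n}" "Y \<subseteq> {1..n}" for X Y
    using that cd_scale_basis_inject[of X n Y 1 1] by simp
  have "B \<noteq> C \<and> Max (sym_diff B C) \<in> C"
    using assms sub inj unfolding triad_def basis_less_def eq by metis
  moreover have "C \<noteq> D \<and> Max (sym_diff C D) \<in> D"
    using assms sub inj unfolding triad_def basis_less_def eq by metis
  \<comment> \<open>This excludes \<open>B = D\<close>: the maximum would then lie in both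
    \<open>B\<close> and \<open>C\<close>, hence outside their symmetric difference.\<close>
  moreover have "Max (sym_diff B C) \<in> sym_diff B C" if "B \<noteq> C"
    using that sub by (intro Max_in) (auto intro: finite_subset[OF _ finite_atLeastAtMost])
  ultimately have "distinct [B, C, D]"
    by (auto simp: Un_commute)
  then show thesis
    using that sub eq by (blast intro: signed_basis_basis)
qed

section \<open>Combinatorics of the 24 triples\<close>

lemma distinct_triples_types:
  assumes "distinct [a, b, c, d]"
  shows "distinct_triples {a, b, c, d} =
     (type1 a b c d \<union> type2 a b c d \<union> type3 a b c d) \<union>
     reverse_triple ` (type1 a b c d \<union> type2 a b c d \<union> type3 a b c d)" (is "?L = ?R")
proof
  have "(x, y, z) \<in> ?R"
    if "x \<in> {a, b, c, d}" "y \<in> {a, b, c, d}" "z \<in> {a, b, c, d}" "distinct [x, y, z]" for x y z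
    by (insert that, elim insertE emptyE;
      simp add: type1_def type2_def type3_def reverse_triple_def)
  then show "?L \<subseteq> ?R" unfolding distinct_triples_def by blast
  show "?R \<subseteq> ?L"
    using assms
    by (simp add: distinct_triples_def type1_def type2_def type3_def reverse_triple_def eq_commute)
qed

lemma card_distinct_triples:
  assumes "distinct [a, b, c, d]"
  shows "card (distinct_triples {a, b, c, d}) = 24"
proof -
  have ne: "a \<noteq> b" "b \<noteq> a" "a \<noteq> c" "c \<noteq> a" "a \<noteq> d" "d \<noteq> a" "b \<noteq> c" "c \<noteq> b" "b \<noteq> d" "d \<noteq> b"
    "c \<noteq> d" "d \<noteq> c"
    using assms by auto
  show ?thesis
    unfolding distinct_triples_types[OF assms] type1_def type2_def type3_def reverse_triple_def
    by (simp add: ne)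
qed

section \<open>The three classes of associators of a triad\<close>

theorem theorem2:
  fixes n :: nat and a b c d :: cd
  assumes "n \<ge> 2"
    and "triad n b c d"
    and "a = (b * c) * d"
  shows "distinct [a, b, c, d] \<and>
         card (distinct_triples {a, b, c, d}) = 24 \<and>
         (\<forall>(x, y, z) \<in> distinct_triples {a, b, c, d}. associator x y z = - associator z y x) \<and>
         card (type1 a b c d \<union> type2 a b c d \<union> type3 a b c d) = 12 \<and>
         type1 a b c d \<inter> type2 a b c d = {} \<and>
         type1 a b c d \<inter> type3 a b c d = {} \<and>
         type2 a b c d \<inter> type3 a b c d = {} \<and>
         distinct_triples {a, b, c, d} =
           (type1 a b c d \<union> type2 a b c d \<union> type3 a b c d) \<union>
           reverse_triple ` (type1 a b c d \<union> type2 a b c d \<union> type3 a b c d) \<and>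
         (\<forall>T \<in> {type1 a b c d, type2 a b c d, type3 a b c d}.
           (\<forall>(x, y, z) \<in> T. associator x y z = cd_zero n) \<or>
           (\<forall>(x, y, z) \<in> T. associator x y z \<noteq> cd_zero n))"
proof -
  obtain B C D where sb: "signed_basis n B b" "signed_basis n C c" "signed_basis n D d"
    and dist: "distinct [B, C, D]"
    using triad_index_sets[OF assms(2)] .
  define A where "A = B \<triangle> C \<triangle> D"
  have sa: "signed_basis n A a"
    unfolding A_def assms(3) by (intro signed_basis_mult sb)
  have D_eq: "D = A \<triangle> B \<triangle> C"
    unfolding A_def by (auto simp: sdiff_def)
  have distA: "distinct [A, B, C, D]"
  proof -
    \<comment> \<open>If \<open>A\<close> equalled one of the other three sets, the remaining two
      would coincide.\<close>
    have AB: "A \<triangle> B = C \<triangle> D" "A \<triangle> C = B \<triangle> D" "A \<triangle> D = B \<triangle> C"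
      unfolding A_def by (auto simp: sdiff_def)
    have "A \<noteq> B" "A \<noteq> C" "A \<noteq> D"
      using dist AB sdiff_simps(5) by (metis distinct_length_2_or_more)+
    then show ?thesis using dist by simp
  qed
  then have dista: "distinct [a, b, c, d]"
    using sa sb signed_basis_inject by auto
  \<comment> \<open>Recovering the index set from the element allows the symmetries to be stated
    once for every arrangement x, y, z, w of the four elements.\<close>
  define I where "I = (\<lambda>x. if x = a then A else if x = b then B else if x = c then C else D)"
  have I_simps: "I a = A" "I b = B" "I c = C" "I d = D"
    using dista by (auto simp: I_def)
  have I_basis: "signed_basis n (I x) x" if "x \<in> {a, b, c, d}" for x
    using that sa sb I_simps by auto
  have I_inj: "I x \<noteq> I y" if "x \<in> {a, b, c, d}" "y \<in> {a, b, c, d}" "x \<noteq> y" for x y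
    using that distA by (elim insertE emptyE; simp add: I_simps) metis+
  have I_sum: "I x \<triangle> I y \<triangle> I z \<triangle> I w = A \<triangle> B \<triangle> C \<triangle> D"
    if "x \<in> {a, b, c, d}" "y \<in> {a, b, c, d}" "z \<in> {a, b, c, d}" "w \<in> {a, b, c, d}"
      "distinct [x, y, z, w]" for x y z w
    by (insert that, elim insertE emptyE; simp only: I_simps sdiff_ac distinct_length_2_or_more simp_thms)
  have sym: "associator x y z = - associator z y x"
      "associator y z w = cd_zero n \<longleftrightarrow> associator x y z = cd_zero n"
    if "x \<in> {a, b, c, d}" "y \<in> {a, b, c, d}" "z \<in> {a, b, c, d}" "w \<in> {a, b, c, d}"
      "distinct [x, y, z, w]" for x y z w
  proof -
    have "I x \<triangle> I y \<triangle> I z \<triangle> I w = {}"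
      using I_sum[OF that] D_eq by simp
    then have "I w = I x \<triangle> I y \<triangle> I z" by simp
    moreover have "distinct [I x, I y, I z, I w]"
      using that I_inj by simp
    ultimately show "associator x y z = - associator z y x"
      "associator y z w = cd_zero n \<longleftrightarrow> associator x y z = cd_zero n"
      using associator_symmetries[OF I_basis[OF that(1)] I_basis[OF that(2)] I_basis[OF that(3)]
          I_basis[OF that(4)]] by blast+
  qed
  have anti: "associator x y z = - associator z y x"
    if "(x, y, z) \<in> distinct_triples {a, b, c, d}" for x y z
  proof -
    have xyz: "x \<in> {a, b, c, d}" "y \<in> {a, b, c, d}" "z \<in> {a, b, c, d}" "distinct [x, y, z]"
      using that by (auto simp: distinct_triples_def)
    have "card ({a, b, c, d} - {x, y, z}) = 1"
      using xyz dista by (subst card_Diff_subset) auto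
    then obtain w where "{a, b, c, d} - {x, y, z} = {w}"
      by (auto simp: card_1_singleton_iff)
    then have "w \<in> {a, b, c, d}" "w \<notin> {x, y, z}" by blast+
    with xyz show ?thesis by (intro sym(1)[of x y z w]) auto
  qed
  have zero_rev: "associator z y x = cd_zero n \<longleftrightarrow> associator x y z = cd_zero n"
    if "x \<in> {a, b, c, d}" "y \<in> {a, b, c, d}" "z \<in> {a, b, c, d}" "distinct [x, y, z]" for x y z
  proof -
    have "(x, y, z) \<in> distinct_triples {a, b, c, d}" "(z, y, x) \<in> distinct_triples {a, b, c, d}"
      using that unfolding distinct_triples_def by auto
    from this[THEN anti] show ?thesis by (metis cd_zero_simps(2))
  qed
  \<comment> \<open>Rotating the cycle b, a, c, d gives [b,a,c], [a,c,d], [c,d,b], [d,b,a];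
    reversing the last two gives the listed [b,d,c] and [a,b,d].\<close>
  have zero1: "associator t1 t2 t3 = cd_zero n \<longleftrightarrow> associator b a c = cd_zero n"
    if "(t1, t2, t3) \<in> type1 a b c d" for t1 t2 t3
    using that dista sym(2)[of b a c d] sym(2)[of a c d b] sym(2)[of c d b a]
      sym(2)[of d b a c] zero_rev[of c d b] zero_rev[of d b a]
    by (auto simp: type1_def)
  \<comment> \<open>The same for the cycle a, b, c, d, where [c,d,a] and [d,a,b] are
    reversed.\<close>
  have zero2: "associator t1 t2 t3 = cd_zero n \<longleftrightarrow> associator a b c = cd_zero n"
    if "(t1, t2, t3) \<in> type2 a b c d" for t1 t2 t3
    using that dista sym(2)[of a b c d] sym(2)[of b c d a] sym(2)[of c d a b]
      zero_rev[of c d a] zero_rev[of d a b]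
    by (auto simp: type2_def)
  \<comment> \<open>The remaining cycle is a, c, b, d, where [b,d,a] and [d,a,c] are
    reversed.\<close>
  have zero3: "associator t1 t2 t3 = cd_zero n \<longleftrightarrow> associator a c b = cd_zero n"
    if "(t1, t2, t3) \<in> type3 a b c d" for t1 t2 t3
    using that dista sym(2)[of a c b d] sym(2)[of c b d a] sym(2)[of b d a c]
      zero_rev[of b d a] zero_rev[of d a c]
    by (auto simp: type3_def)
  have zero: "(\<forall>(x, y, z) \<in> T. associator x y z = cd_zero n) \<or>
      (\<forall>(x, y, z) \<in> T. associator x y z \<noteq> cd_zero n)"
    if "T \<in> {type1 a b c d, type2 a b c d, type3 a b c d}" for T
    using that zero1 zero2 zero3 by (elim insertE emptyE) (hypsubst, blast)+
  have "card (type1 a b c d \<union> type2 a b c d \<union> type3 a b c d) = 12"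
    using dista by (simp add: type1_def type2_def type3_def card_insert_if) auto
  moreover have "type1 a b c d \<inter> type2 a b c d = {}" "type1 a b c d \<inter> type3 a b c d = {}"
      "type2 a b c d \<inter> type3 a b c d = {}"
    using dista by (auto simp: type1_def type2_def type3_def)
  moreover have "\<forall>(x, y, z) \<in> distinct_triples {a, b, c, d}. associator x y z = - associator z y x"
    by (intro ballI case_prodI2) (rule anti, simp only:)
  moreover have "\<forall>T \<in> {type1 a b c d, type2 a b c d, type3 a b c d}.
      (\<forall>(x, y, z) \<in> T. associator x y z = cd_zero n) \<or>
      (\<forall>(x, y, z) \<in> T. associator x y z \<noteq> cd_zero n)"
    using zero by (rule ballI)
  ultimately show ?thesis
    using dista card_distinct_triples[OF dista] distinct_triples_types[OF dista]
    by (intro conjI)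
qed

end
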